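(* Let $A,B,C$ be three logically independent events and let $\mathcal I=[x_1,x_2]\times[y_1,y_2]\times[t_1,t_2]\subseteq[0,1]^3$ be an imprecise assessment on $(C|B,\ A|B,\ B|(A\vee B))$. Then the set $\Sigma$ of the coherent extensions of $\mathcal I$ to $C|A$ is the interval $[z^*,z^{**}]$, where \[ z^*=\begin{cases}0, & \text{if } t_1(x_1+y_1-1)\le 0,\\[2pt] \dfrac{t_1(x_1+y_1-1)}{1-t_1(1-y_1)}, & \text{if } t_1(x_1+y_1-1)>0,\end{cases} \] and \[ z^{**}=\begin{cases}1, & \text{if } t_1(y_1-x_2)\le 0,\\[2pt] 1-\dfrac{t_1(y_1-x_2)}{1-t_1(1-y_1)}, & \text{if } t_1(y_1-x_2)>0.\end{cases} \]
   Context: Events are elements of a Boolean algebra (e.g. subsets of a set $\Omega$), identified with their $\{0,1\}$-valued indicators; $\overline{E}$ is the negation of $E$ and juxtaposition or $\wedge$ is conjunction. Events $A,B,C$ are logically independent if all $8$ conjunctions obtained by choosing each of them or its negation are different from the impossible event $\bot$. For events $E,H$ with $H\ne\bot$, the conditional event $E|H$ is true if $EH$ is true, false if $\overline{E}H$ is true, and void if $H$ is false. Coherence: an assessment $\mathcal P=(p_1,\dots,p_n)\in\mathbb R^n$ on $\mathcal F=(E_1|H_1,\dots,E_n|H_n)$ is coherent if for every nonempty $J\subseteq\{1,\dots,n\}$ and all real numbers $s_j$ ($j\in J$), the random gain $G=\sum_{j\in J}s_jH_j(E_j-p_j)$, restricted to $\bigvee_{j\in J}H_j$ (i.e. considering only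 its values when at least one $H_j$, $j\in J$, is true), has minimum $\le 0$ and maximum $\ge 0$. An imprecise assessment on $\mathcal F$ is a set $\mathcal I\subseteq[0,1]^n$ of precise assessments on $\mathcal F$. The set $\Sigma$ of coherent extensions of $\mathcal I$ to a further conditional event $E_{n+1}|H_{n+1}$ is the set of all $z\in[0,1]$ such that, for some coherent $\mathcal P\in\mathcal I$, the assessment $(\mathcal P,z)$ on $(\mathcal F,E_{n+1}|H_{n+1})$ is coherent. The intervals $[x_1,x_2]$, $[y_1,y_2]$, $[t_1,t_2]$ are nonempty. *)

theory Defs
  imports "HOL-Analysis.Analysis"
begin

text \<open>
  Events are the elements of an arbitrary Boolean algebra; \<open>inf\<close>, \<open>sup\<close>, \<open>-\<close> and \<open>bot\<close> are
  conjunction, disjunction, negation and the impossible event.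
\<close>

definition literal :: "'a::boolean_algebra \<Rightarrow> bool \<Rightarrow> 'a" where
  "literal E v = (if v then E else - E)"

definition logically_independent3 :: "'a::boolean_algebra \<Rightarrow> 'a \<Rightarrow> 'a \<Rightarrow> bool" where
  "logically_independent3 A B C \<longleftrightarrow>
     (\<forall>a b c. inf (inf (literal A a) (literal B b)) (literal C c) \<noteq> bot)"

text \<open>\<open>Cond E H\<close> stands for the conditional event E|H.\<close>

datatype 'a cond_event = Cond (event: 'a) (given: 'a)

text \<open>
  For a finite nonempty index set J, \<open>constituent F J T D\<close> is the conjunction saying that, among the
  indices in J, exactly those in T have a true event and exactly those in D have a true conditioning
  event. The pairs (T, D) of subsets of J whose constituent differs from \<open>bot\<close> are the possible cases.
\<close>

definition constituent ::
  "'a::boolean_algebra cond_event list \<Rightarrow> nat set \<Rightarrow> nat set \<Rightarrow> nat set \<Rightarrow> 'a" where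
  "constituent F J T D =
     Inf_fin ((\<lambda>j. inf (literal (event (F ! j)) (j \<in> T)) (literal (given (F ! j)) (j \<in> D))) ` J)"

text \<open>
  The possible values of the random gain G, the sum over j in J of \<open>s\<^sub>j H\<^sub>j (E\<^sub>j - p\<^sub>j)\<close>, when at least
  one conditioning event with index in J is true; in the case (T, D) the latter means that D is nonempty.
\<close>

definition gain_values ::
  "'a::boolean_algebra cond_event list \<Rightarrow> real list \<Rightarrow> nat set \<Rightarrow> (nat \<Rightarrow> real) \<Rightarrow> real set" where
  "gain_values F p J s =
     {\<Sum>j\<in>J. s j * of_bool (j \<in> D) * (of_bool (j \<in> T) - p ! j) | T D.
        T \<subseteq> J \<and> D \<subseteq> J \<and> D \<noteq> {} \<and> constituent F J T D \<noteq> bot}"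

text \<open>
  The set of gain values is finite, and it is nonempty because conditioning events are required to
  differ from \<open>bot\<close>, so that \<open>Min\<close> and \<open>Max\<close> are the true minimum and maximum. Indices start at 0.
\<close>

definition coherent :: "'a::boolean_algebra cond_event list \<Rightarrow> real list \<Rightarrow> bool" where
  "coherent F p \<longleftrightarrow>
     length p = length F \<and>
     (\<forall>i<length F. given (F ! i) \<noteq> bot) \<and>
     (\<forall>J s. J \<noteq> {} \<and> J \<subseteq> {..<length F} \<longrightarrow>
        Min (gain_values F p J s) \<le> 0 \<and> 0 \<le> Max (gain_values F p J s))"

definition coherent_extensions ::
  "'a::boolean_algebra cond_event list \<Rightarrow> real list set \<Rightarrow> 'a cond_event \<Rightarrow> real set" where
  "coherent_extensions F I K =
     {z \<in> {0..1}. \<exists>p\<in>I. coherent F p \<and> coherent (F @ [K]) (p @ [z])}"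

lemma finite_gain_values:
  assumes "finite J"
  shows "finite (gain_values F p J s)"
proof -
  have "gain_values F p J s \<subseteq>
    (\<lambda>(T, D). \<Sum>j\<in>J. s j * of_bool (j \<in> D) * (of_bool (j \<in> T) - p ! j)) ` (Pow J \<times> Pow J)"
    unfolding gain_values_def by auto
  with assms show ?thesis
    by (meson finite_Pow_iff finite_SigmaI finite_imageI finite_subset)
qed

text \<open>For algebras of sets, the gain values are the pointwise values of the gain.\<close>

lemma mem_constituent_set:
  fixes F :: "'w set cond_event list"
  assumes "finite J" "J \<noteq> {}"
  shows "w \<in> constituent F J T D \<longleftrightarrow>
    (\<forall>j\<in>J. (j \<in> T \<longleftrightarrow> w \<in> event (F ! j)) \<and> (j \<in> D \<longleftrightarrow> w \<in> given (F ! j)))"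
proof -
  have lit: "w \<in> literal X v \<longleftrightarrow> (v \<longleftrightarrow> w \<in> X)" for X :: "'w set" and v
    by (simp add: literal_def)
  have "constituent F J T D =
    (\<Inter>j\<in>J. literal (event (F ! j)) (j \<in> T) \<inter> literal (given (F ! j)) (j \<in> D))"
    unfolding constituent_def using assms by (intro Inf_fin_Inf) simp_all
  then show ?thesis
    by (simp only: INT_iff Int_iff lit)
qed

lemma gain_values_set:
  fixes F :: "'w set cond_event list"
  assumes "finite J" "J \<noteq> {}"
  shows "gain_values F p J s =
    (\<lambda>w. \<Sum>j\<in>J. s j * indicator (given (F ! j)) w * (indicator (event (F ! j)) w - p ! j)) `
      (\<Union>j\<in>J. given (F ! j))" (is "_ = ?g ` ?U")
proof (rule set_eqI, rule iffI)
  fix v assume "v \<in> gain_values F p J s"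
  then obtain T D where TD: "D \<subseteq> J" "D \<noteq> {}" "constituent F J T D \<noteq> {}"
    and v: "v = (\<Sum>j\<in>J. s j * of_bool (j \<in> D) * (of_bool (j \<in> T) - p ! j))"
    unfolding gain_values_def mem_Collect_eq by metis
  from TD(3) obtain w where "w \<in> constituent F J T D" by blast
  then have w: "\<forall>j\<in>J. (j \<in> T \<longleftrightarrow> w \<in> event (F ! j)) \<and> (j \<in> D \<longleftrightarrow> w \<in> given (F ! j))"
    by (simp only: mem_constituent_set[OF assms])
  have "v = ?g w"
    unfolding v by (rule sum.cong) (simp_all add: w indicator_def)
  moreover have "w \<in> ?U" using w TD(1,2) by blast
  ultimately show "v \<in> ?g ` ?U" by (rule image_eqI)
next
  fix v assume "v \<in> ?g ` ?U"
  then obtain w where v: "v = ?g w" and w: "w \<in> ?U" by (rule imageE)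
  define T where "T = {j\<in>J. w \<in> event (F ! j)}"
  define D where "D = {j\<in>J. w \<in> given (F ! j)}"
  have "w \<in> constituent F J T D"
    unfolding mem_constituent_set[OF assms] by (simp add: T_def D_def)
  then have "constituent F J T D \<noteq> {}" by blast
  moreover have "v = (\<Sum>j\<in>J. s j * of_bool (j \<in> D) * (of_bool (j \<in> T) - p ! j))"
    unfolding v by (rule sum.cong) (simp_all add: T_def D_def indicator_def)
  moreover have "T \<subseteq> J" "D \<subseteq> J" by (simp_all add: T_def D_def)
  moreover have "D \<noteq> {}" using w unfolding D_def by blast
  ultimately show "v \<in> gain_values F p J s"
    unfolding gain_values_def mem_Collect_eq by metis
qed

end

theory Submission
  imports Defs
begin

text \<open>
  Write \<open>x, y, t, z\<close> for the values of \<open>C|B\<close>, \<open>A|B\<close>, \<open>B|(A \<or> B)\<close> and \<open>C|A\<close>. If they are the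
  conditional probabilities of some measure that gives \<open>A \<or> B\<close> mass 1, then \<open>B\<close>, \<open>BC\<close>, \<open>AB\<close>, \<open>A\<close> and
  \<open>AC\<close> have the masses \<open>t\<close>, \<open>tx\<close>, \<open>ty\<close>, \<open>d = 1 - t(1 - y)\<close> and \<open>dz\<close>. Since \<open>AC\<close> contains \<open>ABC\<close>, whose
  mass is at least \<open>tx + ty - t\<close>, and the part of \<open>A\<close> outside \<open>C\<close> contains the part of \<open>AB\<close> outside
  \<open>C\<close>, whose mass is at least \<open>ty - tx\<close>,
  \<open>t(x + y - 1) \<le> dz\<close> and \<open>t(y - x) \<le> d(1 - z)\<close>.
  For values in the unit interval these two inequalities characterize coherence
  (\<open>coherent_iff_bounds\<close>). They are necessary because their violation turns the two
  inclusions into a bet with a sure gain. They are sufficient because they leave room for a suitable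
  mass \<open>q\<close> of \<open>ABC\<close>, and under a measure with the assessed conditional probabilities every gain has
  expectation 0, so it cannot be positive throughout (\<open>ex_nonpos_world_gain\<close>). A conditioning event
  may have mass 0 under the measure just described; bets all of whose conditioning events have mass 0
  are handled by a measure concentrated on \<open>B\<close> or on \<open>A\<close>.

  The second inequality is the first one with \<open>1 - x\<close> and \<open>1 - z\<close> in place of \<open>x\<close> and \<open>z\<close>, that is,
  with \<open>C\<close> negated. For fixed \<open>z\<close>, decreasing \<open>x\<close>, \<open>y\<close> or \<open>t\<close> preserves the first inequality
  (\<open>lower_bound_antimono\<close>). So if \<open>z\<close> is an extension of any point of the box, it satisfies the
  first inequality at \<open>(x\<^sub>1, y\<^sub>1, t\<^sub>1)\<close> and the second at \<open>(x\<^sub>2, y\<^sub>1, t\<^sub>1)\<close>. Conversely, at \<open>(y\<^sub>1, t\<^sub>1)\<close> the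
  two inequalities confine \<open>t\<^sub>1x\<close> to a nonempty interval, and the two corner inequalities say that
  this interval meets the one from \<open>t\<^sub>1x\<^sub>1\<close> to \<open>t\<^sub>1x\<^sub>2\<close>, so some \<open>x\<close> in the box satisfies both. Solving the two corner inequalities for \<open>z\<close> gives the endpoints.
\<close>

section \<open>Coherence over a partition into possible worlds\<close>

lemma inf_literal_not [simp]: "inf (literal E v) (literal E (\<not> v)) = bot"
  by (simp add: literal_def)

text \<open>
  The lists \<open>E\<close> and \<open>H\<close> hold the truth functions of the conditioned and of the conditioning events.
\<close>

definition world_gain ::
  "('w \<Rightarrow> bool) list \<Rightarrow> ('w \<Rightarrow> bool) list \<Rightarrow> real list \<Rightarrow> nat set \<Rightarrow> (nat \<Rightarrow> real) \<Rightarrow> 'w \<Rightarrow> real" where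
  "world_gain E H p J s w =
     (\<Sum>j\<in>J. s j * of_bool ((H ! j) w) * (of_bool ((E ! j) w) - p ! j))"

text \<open>
  Possible worlds may be coarser than the points of a sample space: they only have to settle the
  listed events. This stands in for a set representation of the Boolean algebra.
\<close>

locale world_partition =
  fixes atom :: "'w \<Rightarrow> 'a::boolean_algebra"
    and F :: "'a cond_event list"
    and E H :: "('w \<Rightarrow> bool) list"
  assumes atom_possible: "atom w \<noteq> bot"
    and atoms_exhaustive: "X \<noteq> bot \<Longrightarrow> \<exists>w. inf (atom w) X \<noteq> bot"
    and event_decided: "j < length F \<Longrightarrow> atom w \<le> literal (event (F ! j)) ((E ! j) w)"
    and given_decided: "j < length F \<Longrightarrow> atom w \<le> literal (given (F ! j)) ((H ! j) w)"
begin

lemma consistent_literal: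
  assumes "atom w \<le> literal X u" "Y \<le> literal X v" "inf (atom w) Y \<noteq> bot"
  shows "u = v"
proof (rule ccontr)
  assume "u \<noteq> v"
  then have "v = (\<not> u)" by blast
  with assms(1,2) have "inf (atom w) Y \<le> inf (literal X u) (literal X (\<not> u))"
    by (meson inf_mono)
  with assms(3) show False by (simp add: le_bot)
qed

text \<open>
  A constituent other than \<open>bot\<close> meets some world, and that world then settles the events in \<open>J\<close> as
  the constituent does. Conversely, each world lies below the constituent that it determines.
\<close>

lemma gain_values_eq_world_gain:
  assumes J: "J \<noteq> {}" "J \<subseteq> {..<length F}"
  shows "gain_values F p J s = world_gain E H p J s ` {w. \<exists>j\<in>J. (H ! j) w}"
proof (intro equalityI subsetI)
  have fin: "finite J" using J(2) finite_subset by blast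
  fix v assume "v \<in> gain_values F p J s"
  then obtain T D where TD: "T \<subseteq> J" "D \<subseteq> J" "D \<noteq> {}" "constituent F J T D \<noteq> bot"
    and v: "v = (\<Sum>j\<in>J. s j * of_bool (j \<in> D) * (of_bool (j \<in> T) - p ! j))"
    unfolding gain_values_def by blast
  obtain w where w: "inf (atom w) (constituent F J T D) \<noteq> bot"
    using atoms_exhaustive[OF TD(4)] by blast
  have ev: "(E ! j) w = (j \<in> T)" and gv: "(H ! j) w = (j \<in> D)" if j: "j \<in> J" for j
  proof -
    have "constituent F J T D \<le> inf (literal (event (F ! j)) (j \<in> T)) (literal (given (F ! j)) (j \<in> D))"
      unfolding constituent_def using fin j by (intro Inf_fin.coboundedI) auto
    then have le: "constituent F J T D \<le> literal (event (F ! j)) (j \<in> T)"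
      "constituent F J T D \<le> literal (given (F ! j)) (j \<in> D)" by simp_all
    have "j < length F" using J(2) j by blast
    then show "(E ! j) w = (j \<in> T)" "(H ! j) w = (j \<in> D)"
      using consistent_literal[OF event_decided le(1) w] consistent_literal[OF given_decided le(2) w]
      by simp_all
  qed
  have "v = world_gain E H p J s w"
    unfolding v world_gain_def by (rule sum.cong) (simp_all add: ev gv)
  moreover have "\<exists>j\<in>J. (H ! j) w" using TD(2,3) gv by blast
  ultimately show "v \<in> world_gain E H p J s ` {w. \<exists>j\<in>J. (H ! j) w}" by blast
next
  have fin: "finite J" using J(2) finite_subset by blast
  fix v assume "v \<in> world_gain E H p J s ` {w. \<exists>j\<in>J. (H ! j) w}"
  then obtain w where v: "v = world_gain E H p J s w" and w: "\<exists>j\<in>J. (H ! j) w" by blast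
  define T where "T = {j\<in>J. (E ! j) w}"
  define D where "D = {j\<in>J. (H ! j) w}"
  have "atom w \<le> inf (literal (event (F ! j)) (j \<in> T)) (literal (given (F ! j)) (j \<in> D))"
    if "j \<in> J" for j
    using event_decided[of j w] given_decided[of j w] that J(2) by (auto simp: T_def D_def)
  then have "atom w \<le> constituent F J T D"
    unfolding constituent_def using fin J(1) by (intro Inf_fin.boundedI) auto
  then have "constituent F J T D \<noteq> bot" using atom_possible[of w] by (metis le_bot)
  moreover have "v = (\<Sum>j\<in>J. s j * of_bool (j \<in> D) * (of_bool (j \<in> T) - p ! j))"
    unfolding v world_gain_def by (rule sum.cong) (simp_all add: T_def D_def)
  moreover have "T \<subseteq> J" "D \<subseteq> J" "D \<noteq> {}" using w by (auto simp: T_def D_def)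
  ultimately show "v \<in> gain_values F p J s"
    unfolding gain_values_def mem_Collect_eq by (intro exI[of _ T] exI[of _ D] conjI)
qed

text \<open>
  Reversing all stakes turns the maximum into the negative of the minimum, so the condition on
  minima, required for all stakes, already contains the one on maxima.
\<close>

lemma coherent_iff_no_sure_gain:
  assumes len: "length p = length F" and given_possible: "\<And>j. j < length F \<Longrightarrow> \<exists>w. (H ! j) w"
  shows "coherent F p \<longleftrightarrow>
    (\<forall>J s. J \<noteq> {} \<and> J \<subseteq> {..<length F} \<longrightarrow>
       (\<exists>w. (\<exists>j\<in>J. (H ! j) w) \<and> world_gain E H p J s w \<le> 0))"
proof -
  have nonbot: "given (F ! j) \<noteq> bot" if j: "j < length F" for j
  proof -
    obtain w where "(H ! j) w" using given_possible[OF j] by blast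
    with given_decided[OF j, of w] have "atom w \<le> given (F ! j)" by (simp add: literal_def)
    then show ?thesis using atom_possible[of w] by (metis le_bot)
  qed
  have minmax: "Min (gain_values F p J s) \<le> 0 \<longleftrightarrow>
      (\<exists>w. (\<exists>j\<in>J. (H ! j) w) \<and> world_gain E H p J s w \<le> 0)"
    "0 \<le> Max (gain_values F p J s) \<longleftrightarrow>
      (\<exists>w. (\<exists>j\<in>J. (H ! j) w) \<and> world_gain E H p J (\<lambda>j. - s j) w \<le> 0)"
    if J: "J \<noteq> {}" "J \<subseteq> {..<length F}" for J s
  proof -
    have "finite (gain_values F p J s)"
      using J(2) finite_subset by (blast intro: finite_gain_values)
    moreover have "gain_values F p J s \<noteq> {}"
      using given_possible J unfolding gain_values_eq_world_gain[OF J] by fastforce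
    moreover have "world_gain E H p J (\<lambda>j. - s j) w = - world_gain E H p J s w" for w
      by (simp add: world_gain_def sum_negf)
    ultimately show "Min (gain_values F p J s) \<le> 0 \<longleftrightarrow>
      (\<exists>w. (\<exists>j\<in>J. (H ! j) w) \<and> world_gain E H p J s w \<le> 0)"
    "0 \<le> Max (gain_values F p J s) \<longleftrightarrow>
      (\<exists>w. (\<exists>j\<in>J. (H ! j) w) \<and> world_gain E H p J (\<lambda>j. - s j) w \<le> 0)"
      by (auto simp: Min_le_iff Max_ge_iff gain_values_eq_world_gain[OF J])
  qed
  show ?thesis
  proof
    assume "coherent F p"
    then have "Min (gain_values F p J s) \<le> 0" if "J \<noteq> {}" "J \<subseteq> {..<length F}" for J s
      using that unfolding coherent_def by blast
    then show "\<forall>J s. J \<noteq> {} \<and> J \<subseteq> {..<length F} \<longrightarrow>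
        (\<exists>w. (\<exists>j\<in>J. (H ! j) w) \<and> world_gain E H p J s w \<le> 0)"
      using minmax(1) by meson
  next
    assume *: "\<forall>J s. J \<noteq> {} \<and> J \<subseteq> {..<length F} \<longrightarrow>
        (\<exists>w. (\<exists>j\<in>J. (H ! j) w) \<and> world_gain E H p J s w \<le> 0)"
    have "Min (gain_values F p J s) \<le> 0 \<and> 0 \<le> Max (gain_values F p J s)"
      if "J \<noteq> {}" "J \<subseteq> {..<length F}" for J s
      unfolding minmax[OF that] using *[rule_format, OF conjI[OF that]] by blast
    with len nonbot show "coherent F p" unfolding coherent_def by blast
  qed
qed

end

text \<open>
  The easy half of de Finetti's theorem. The gain has expectation 0 under \<open>\<mu>\<close> and vanishes where all
  bets in \<open>J\<close> are void, so it cannot be positive everywhere else unless \<open>\<mu>\<close> gives mass 0 to all the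
  conditioning events in \<open>J\<close>; the index \<open>k\<close> excludes this.
\<close>

lemma ex_nonpos_world_gain:
  fixes \<mu> :: "'w::finite \<Rightarrow> real"
  assumes nonneg: "\<And>w. 0 \<le> \<mu> w"
    and fair: "\<And>j. j \<in> J \<Longrightarrow>
      (\<Sum>w\<in>UNIV. \<mu> w * of_bool ((H ! j) w) * (of_bool ((E ! j) w) - p ! j)) = 0"
    and k: "k \<in> J" "0 < (\<Sum>w\<in>UNIV. \<mu> w * of_bool ((H ! k) w))"
  shows "\<exists>w. (\<exists>j\<in>J. (H ! j) w) \<and> world_gain E H p J s w \<le> 0"
proof (rule ccontr)
  assume neg: "\<not> ?thesis"
  then have pos: "0 < world_gain E H p J s w" if "\<exists>j\<in>J. (H ! j) w" for w
    using that by force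
  have void: "world_gain E H p J s w = 0" if "\<not> (\<exists>j\<in>J. (H ! j) w)" for w
    unfolding world_gain_def using that by (intro sum.neutral) auto
  have terms: "0 \<le> \<mu> w * world_gain E H p J s w" for w
    using nonneg[of w] pos[of w] void[of w] by (cases "\<exists>j\<in>J. (H ! j) w") auto
  have "(\<Sum>w\<in>UNIV. \<mu> w * world_gain E H p J s w) =
      (\<Sum>w\<in>UNIV. \<Sum>j\<in>J. s j * (\<mu> w * of_bool ((H ! j) w) * (of_bool ((E ! j) w) - p ! j)))"
    unfolding world_gain_def by (simp add: sum_distrib_left mult_ac)
  also have "\<dots> =
      (\<Sum>j\<in>J. s j * (\<Sum>w\<in>UNIV. \<mu> w * of_bool ((H ! j) w) * (of_bool ((E ! j) w) - p ! j)))"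
    unfolding sum_distrib_left by (rule sum.swap)
  also have "\<dots> = 0" using fair by (simp add: sum.neutral)
  finally have "\<mu> w * world_gain E H p J s w = 0" for w
    using terms by (simp add: sum_nonneg_eq_0_iff)
  then have "\<mu> w * of_bool ((H ! k) w) = 0" for w
    using pos[of w] k(1) by fastforce
  then show False using k(2) by (simp only: sum.neutral_const less_irrefl)
qed

lemma coherent_butlast:
  assumes "coherent (F @ [K]) (p @ [z])"
  shows "coherent F p"
proof -
  have len: "length p = length F" using assms by (simp add: coherent_def)
  have "gain_values (F @ [K]) (p @ [z]) J s = gain_values F p J s" if J: "J \<subseteq> {..<length F}" for J s
  proof -
    have "constituent (F @ [K]) J T D = constituent F J T D" for T D
      unfolding constituent_def using J by (intro arg_cong[where f = Inf_fin] image_cong) (auto simp: nth_append)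
    moreover have "(\<Sum>j\<in>J. s j * of_bool (j \<in> D) * (of_bool (j \<in> T) - (p @ [z]) ! j)) =
        (\<Sum>j\<in>J. s j * of_bool (j \<in> D) * (of_bool (j \<in> T) - p ! j))" for T D
      using J len by (intro sum.cong) (auto simp: nth_append)
    ultimately show ?thesis unfolding gain_values_def by simp
  qed
  moreover have "given (F ! i) \<noteq> bot" if "i < length F" for i
    using assms that by (auto simp: coherent_def nth_append less_Suc_eq)
  moreover have "J \<subseteq> {..<length (F @ [K])}" if "J \<subseteq> {..<length F}" for J
    using that by auto
  ultimately show ?thesis using assms len unfolding coherent_def by metis
qed

section \<open>Coherent assessments on the four conditional events\<close>

definition atom3 :: "'a::boolean_algebra \<Rightarrow> 'a \<Rightarrow> 'a \<Rightarrow> bool \<times> bool \<times> bool \<Rightarrow> 'a" where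
  "atom3 A B C = (\<lambda>(a, b, c). inf (inf (literal A a) (literal B b)) (literal C c))"

abbreviation (input) events4 :: "(bool \<times> bool \<times> bool \<Rightarrow> bool) list" where
  "events4 \<equiv> [\<lambda>(a, b, c). c, \<lambda>(a, b, c). a, \<lambda>(a, b, c). b, \<lambda>(a, b, c). c]"

abbreviation (input) givens4 :: "(bool \<times> bool \<times> bool \<Rightarrow> bool) list" where
  "givens4 \<equiv> [\<lambda>(a, b, c). b, \<lambda>(a, b, c). b, \<lambda>(a, b, c). a \<or> b, \<lambda>(a, b, c). a]"

lemma sum_bool3:
  "(\<Sum>w\<in>UNIV. f w) = f (True, True, True) + f (True, True, False) + f (True, False, True)
     + f (True, False, False) + f (False, True, True) + f (False, True, False)
     + f (False, False, True) + f (False, False, False)"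
  for f :: "bool \<times> bool \<times> bool \<Rightarrow> real"
  by (simp add: UNIV_Times_UNIV[symmetric] sum.cartesian_product[symmetric] UNIV_bool
      del: UNIV_Times_UNIV)

lemma world_partition_atom3:
  assumes "logically_independent3 A B C"
  shows "world_partition (atom3 A B C) [Cond C B, Cond A B, Cond B (sup A B), Cond C A]
    events4 givens4"
proof
  show "atom3 A B C w \<noteq> bot" for w
    using assms by (auto simp: logically_independent3_def atom3_def split: prod.split)
  show "\<exists>w. inf (atom3 A B C w) X \<noteq> bot" if X: "X \<noteq> bot" for X
  proof -
    have split: "\<exists>v. inf Y (literal E v) \<noteq> bot" if "Y \<noteq> bot" for Y E :: 'a
    proof (rule ccontr)
      assume "\<not> ?thesis"
      then have "inf Y (literal E True) = bot" "inf Y (literal E False) = bot" by blast+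
      then have "inf Y (sup E (- E)) = bot" unfolding inf_sup_distrib1 by (simp add: literal_def)
      with that show False by simp
    qed
    obtain a where "inf X (literal A a) \<noteq> bot" using split[OF X] by blast
    then obtain b where "inf (inf X (literal A a)) (literal B b) \<noteq> bot" using split by blast
    then obtain c where "inf (inf (inf X (literal A a)) (literal B b)) (literal C c) \<noteq> bot"
      using split by blast
    then have "inf (atom3 A B C (a, b, c)) X \<noteq> bot" by (simp add: atom3_def inf_commute inf_left_commute)
    then show ?thesis ..
  qed
next
  have [simp]: "atom3 A B C (a, b, c) \<le> literal A a" "atom3 A B C (a, b, c) \<le> literal B b"
    "atom3 A B C (a, b, c) \<le> literal C c" for a b c
    by (simp_all add: atom3_def le_infI1 le_infI2)
  have [simp]: "atom3 A B C (a, b, c) \<le> literal (sup A B) (a \<or> b)" for a b c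
    by (auto simp: atom3_def literal_def le_infI1 le_infI2 le_supI1 le_supI2)
  fix j and w :: "bool \<times> bool \<times> bool"
  obtain a b c where w: "w = (a, b, c)" by (cases w)
  assume "j < length [Cond C B, Cond A B, Cond B (sup A B), Cond C A]"
  then have j: "j \<in> {0, 1, 2, 3}" by auto
  show "atom3 A B C w \<le> literal (event ([Cond C B, Cond A B, Cond B (sup A B), Cond C A] ! j)) ((events4 ! j) w)"
    using j by (auto simp: w)
  show "atom3 A B C w \<le> literal (given ([Cond C B, Cond A B, Cond B (sup A B), Cond C A] ! j)) ((givens4 ! j) w)"
    using j by (auto simp: w)
qed

text \<open>
  The measure gives mass \<open>\<beta>\<close> to \<open>B\<close> and \<open>\<alpha>\<close> to the rest of \<open>A \<or> B\<close>, where \<open>C\<close> has mass \<open>r\<close>; within \<open>B\<close>,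
  the events \<open>A\<close> and \<open>C\<close> have relative masses \<open>y\<close> and \<open>x\<close>, and \<open>ABC\<close> has mass \<open>q\<close>. Bets on \<open>C|B\<close> and
  \<open>A|B\<close> are thus always fair. The other two impose conditions on the masses only if their indices
  are in \<open>J\<close>, which leaves freedom to move mass to \<open>B\<close> or to \<open>A\<close>. The list in the last assumption
  consists of the masses of the four conditioning events.
\<close>

lemma ex_nonpos_gain_of_masses:
  fixes x y t z \<alpha> \<beta> q r :: real
  assumes J: "J \<subseteq> {..<4}"
    and q: "0 \<le> q" "\<beta> * (x + y - 1) \<le> q" "q \<le> \<beta> * x" "q \<le> \<beta> * y"
    and r: "0 \<le> r" "r \<le> \<alpha>"
    and fair_t: "2 \<in> J \<Longrightarrow> t * (\<alpha> + \<beta>) = \<beta>"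
    and fair_z: "3 \<in> J \<Longrightarrow> q + r = z * (\<alpha> + \<beta> * y)"
    and k: "k \<in> J" "0 < [\<beta>, \<beta>, \<alpha> + \<beta>, \<alpha> + \<beta> * y] ! k"
  shows "\<exists>w. (\<exists>j\<in>J. (givens4 ! j) w) \<and> world_gain events4 givens4 [x, y, t, z] J s w \<le> 0"
proof (rule ex_nonpos_world_gain[where k = k])
  define \<mu> :: "bool \<times> bool \<times> bool \<Rightarrow> real" where
    "\<mu> = (\<lambda>(a, b, c).
       if a \<and> b \<and> c then q else if a \<and> b then \<beta> * y - q
       else if b \<and> c then \<beta> * x - q else if b then \<beta> - \<beta> * x - \<beta> * y + q
       else if a \<and> c then r else if a then \<alpha> - r else 0)"
  show "0 \<le> \<mu> w" for w
    using q r by (auto simp: \<mu>_def algebra_simps split: prod.split)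
  show "(\<Sum>w\<in>UNIV. \<mu> w * of_bool ((givens4 ! j) w) * (of_bool ((events4 ! j) w) - [x, y, t, z] ! j)) = 0"
    if j: "j \<in> J" for j
  proof -
    have "j \<in> {0, 1, 2, 3}" using j J by auto
    then consider "j = 0" | "j = 1" | "j = 2" | "j = 3" by blast
    then show ?thesis
    proof cases
      case 3
      with j fair_t show ?thesis by (simp add: sum_bool3 \<mu>_def algebra_simps)
    next
      case 4
      with j fair_z show ?thesis by (simp add: sum_bool3 \<mu>_def algebra_simps)
    qed (simp_all add: sum_bool3 \<mu>_def algebra_simps)
  qed
  have "k \<in> {0, 1, 2, 3}" using k(1) J by auto
  then show "0 < (\<Sum>w\<in>UNIV. \<mu> w * of_bool ((givens4 ! k) w))"
    using k(2) by (auto simp: sum_bool3 \<mu>_def)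
qed (rule k)

text \<open>
  The two inequalities are \<open>P(AC) \<ge> P(AB) + P(BC) - P(B)\<close> and \<open>P(AC) \<le> P(A \<or> B) - P(B) + P(BC)\<close>, the
  latter rearranged to display the symmetry under negation of \<open>C\<close>.
\<close>

lemma coherent_iff_bounds:
  fixes x y t z :: real
  assumes ind: "logically_independent3 A B C"
    and unit: "x \<in> {0..1}" "y \<in> {0..1}" "t \<in> {0..1}" "z \<in> {0..1}"
  shows "coherent [Cond C B, Cond A B, Cond B (sup A B), Cond C A] [x, y, t, z] \<longleftrightarrow>
    t * (x + y - 1) \<le> (1 - t * (1 - y)) * z \<and> t * (y - x) \<le> (1 - t * (1 - y)) * (1 - z)"
    (is "coherent ?F ?p \<longleftrightarrow> ?lower \<and> ?upper")
proof -
  interpret world_partition "atom3 A B C" ?F events4 givens4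
    by (rule world_partition_atom3[OF ind])
  have "\<exists>w. (givens4 ! j) w" if "j < length ?F" for j
  proof -
    have "j \<in> {0, 1, 2, 3}" using that by auto
    then have "(givens4 ! j) (True, True, True)" by auto
    then show ?thesis ..
  qed
  then have coh: "coherent ?F ?p \<longleftrightarrow> (\<forall>J s. J \<noteq> {} \<and> J \<subseteq> {..<4} \<longrightarrow>
       (\<exists>w. (\<exists>j\<in>J. (givens4 ! j) w) \<and> world_gain events4 givens4 ?p J s w \<le> 0))"
    by (subst coherent_iff_no_sure_gain) (auto simp: numeral_eq_Suc)
  show ?thesis
  proof
    assume "coherent ?F ?p"
    have four: "{..<4} = {0, 1, 2, 3::nat}" by auto
    have gain: "\<exists>a b c. (a \<or> b) \<and> world_gain events4 givens4 ?p {0, 1, 2, 3} s (a, b, c) \<le> 0" for s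
      using \<open>coherent ?F ?p\<close>[unfolded coh, rule_format, of "{0, 1, 2, 3}" s]
      by (auto simp: four)
    \<comment> \<open>With these stakes, on \<open>A \<or> B\<close> the gain is the indicator sum \<open>AC - BC - AB + B \<ge> 0\<close> minus the
      constant \<open>(1 - t(1 - y))z - t(x + y - 1)\<close>. The stakes on \<open>A|B\<close> and \<open>B|(A \<or> B)\<close> come from writing
      \<open>A\<close> as \<open>AB + (A \<or> B) - B\<close>.\<close>
    obtain a b c where "a \<or> b" "world_gain events4 givens4 ?p {0, 1, 2, 3}
        ((!) [-1, z - 1, 1 - x - y + z * y - z, 1]) (a, b, c) \<le> 0"
      using gain by blast
    then have ?lower
      by (cases a; cases b; cases c) (simp_all add: world_gain_def algebra_simps)
    \<comment> \<open>Likewise, here the gain is \<open>1 - B + BC - AC \<ge> 0\<close> minus \<open>(1 - t(1 - y))(1 - z) - t(y - x)\<close>.\<close>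
    obtain a b c where "a \<or> b" "world_gain events4 givens4 ?p {0, 1, 2, 3}
        ((!) [1, - z, x - 1 - z * y + z, -1]) (a, b, c) \<le> 0"
      using gain by blast
    then have ?upper
      by (cases a; cases b; cases c) (simp_all add: world_gain_def algebra_simps)
    show "?lower \<and> ?upper" by (rule conjI) fact+
  next
    assume bounds: "?lower \<and> ?upper"
    have prod_unit: "0 \<le> u * v" "u * v \<le> u" "u * v \<le> v"
      if "u \<in> {0..1}" "v \<in> {0..1}" for u v :: real
      using that by (auto intro: mult_left_le mult_left_le_one_le)
    define d where "d = 1 - t + t * y"
    have dz: "0 \<le> d * z" "d * z \<le> d"
      using unit prod_unit[of t y] by (auto simp: d_def mult_left_le)
    \<comment> \<open>The smallest mass of \<open>ABC\<close> that leaves every other world with nonnegative mass, given that \<open>A\<close>,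
      \<open>AC\<close> and \<open>B\<close> have masses \<open>d\<close>, \<open>dz\<close> and \<open>t\<close>.\<close>
    define q where "q = max 0 (max (t * (x + y - 1)) (d * z - (1 - t)))"
    have q_ge: "0 \<le> q" "t * (x + y - 1) \<le> q" "d * z - (1 - t) \<le> q"
      unfolding q_def by simp_all
    have q_le: "q \<le> t * x" "q \<le> t * y" "q \<le> d * z"
      unfolding q_def max.bounded_iff using bounds unit dz prod_unit[of t x] prod_unit[of t y]
      by (auto simp: d_def algebra_simps)
    show "coherent ?F ?p"
      unfolding coh
    proof (intro allI impI)
      fix J :: "nat set" and s :: "nat \<Rightarrow> real"
      assume "J \<noteq> {} \<and> J \<subseteq> {..<4}"
      then have J: "J \<noteq> {}" "J \<subseteq> {..<4}" by blast+
      have J_cases: "J \<subseteq> {0, 1} \<or> J = {3} \<or> 2 \<in> J \<or> 3 \<in> J \<and> J \<inter> {0, 1} \<noteq> {}"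
      proof -
        have "J \<subseteq> {0, 1, 2, 3}" using J(2) by auto
        then show ?thesis using J(1) by blast
      qed
      have full: "\<exists>w. (\<exists>j\<in>J. (givens4 ! j) w) \<and> world_gain events4 givens4 ?p J s w \<le> 0"
        if "k \<in> J" "0 < [t, t, 1, 1 - t + t * y] ! k" for k
        by (rule ex_nonpos_gain_of_masses[where \<alpha> = "1 - t" and \<beta> = t and q = q
              and r = "d * z - q" and k = k])
          (use J q_ge q_le that in \<open>auto simp: d_def algebra_simps\<close>)
      \<comment> \<open>The measure with masses \<open>t\<close> and \<open>1 - t\<close> fits all four bets but may miss \<open>B\<close> (if \<open>t = 0\<close>) or
        \<open>A\<close> (if \<open>t = 1\<close> and \<open>y = 0\<close>). It never misses both, so only bets that are all on \<open>B\<close> or all on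
        \<open>A\<close> need a measure of their own.\<close>
      from J_cases consider (B) "J \<subseteq> {0, 1}" | (A) "J = {3}" | (AB) "2 \<in> J"
        | (mixed) k where "3 \<in> J" "k \<in> J" "k \<in> {0, 1}" by blast
      then show "\<exists>w. (\<exists>j\<in>J. (givens4 ! j) w) \<and> world_gain events4 givens4 ?p J s w \<le> 0"
      proof cases
        case B
        obtain k where k: "k \<in> J" using J(1) by blast
        with B have "0 < [1, 1, 1, y] ! k" by auto
        with B k show ?thesis
          by (intro ex_nonpos_gain_of_masses[where \<alpha> = 0 and \<beta> = 1 and q = "max 0 (x + y - 1)"
                and r = 0 and k = k]) (use J unit in auto)
      next
        case A
        then show ?thesis
          by (intro ex_nonpos_gain_of_masses[where \<alpha> = 1 and \<beta> = 0 and q = 0 and r = z and k = 3])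
            (use unit in auto)
      next
        case AB
        then show ?thesis by (intro full[of 2]) auto
      next
        case mixed
        show ?thesis
        proof (cases "t = 0")
          case True
          with mixed(1) show ?thesis by (intro full[of 3]) auto
        next
          case False
          with mixed(2,3) unit show ?thesis by (intro full[of k]) auto
        qed
      qed
    qed
  qed
qed

section \<open>The extensions of a box of assessments\<close>

text \<open>
  The inequality is equivalent to \<open>t(x - (1 - y)(1 - z)) \<le> z\<close>. The bracket increases with \<open>x\<close> and
  \<open>y\<close>, and \<open>t\<close> matters only when the bracket is positive.
\<close>

lemma lower_bound_antimono:
  fixes x y t z :: real
  assumes bound: "t * (x + y - 1) \<le> (1 - t * (1 - y)) * z"
    and z: "0 \<le> z" "z \<le> 1"
    and le: "x' \<le> x" "y' \<le> y" "0 \<le> t'" "t' \<le> t"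
  shows "t' * (x' + y' - 1) \<le> (1 - t' * (1 - y')) * z"
proof -
  have rearr: "u * (v + w - 1) \<le> (1 - u * (1 - w)) * z \<longleftrightarrow> u * (v - (1 - w) * (1 - z)) \<le> z" for u v w
    by (auto simp: algebra_simps)
  have "x' - (1 - y') * (1 - z) \<le> x - (1 - y) * (1 - z)"
    using z le by (intro diff_mono mult_right_mono) auto
  then have "t' * (x' - (1 - y') * (1 - z)) \<le> t' * (x - (1 - y) * (1 - z))"
    using le(3) by (rule mult_left_mono)
  also have "t' * (x - (1 - y) * (1 - z)) \<le> z"
  proof (cases "0 \<le> x - (1 - y) * (1 - z)")
    case True
    then show ?thesis using bound le(4) unfolding rearr by (meson mult_right_mono order_trans)
  next
    case False
    then have "t' * (x - (1 - y) * (1 - z)) \<le> 0" using le(3) by (intro mult_nonneg_nonpos) auto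
    then show ?thesis using z by linarith
  qed
  finally show ?thesis unfolding rearr .
qed

text \<open>
  The denominator \<open>1 - t(1 - y)\<close> may be 0, but not when the numerator is positive: it is at least
  \<open>ty\<close>, and \<open>ty \<ge> t(x + y - 1)\<close>.
\<close>

lemma lower_bound_threshold:
  fixes x y t z :: real
  assumes "x \<le> 1" "0 \<le> y" "y \<le> 1" "0 \<le> t" "t \<le> 1" "0 \<le> z"
  shows "(if t * (x + y - 1) \<le> 0 then 0 else t * (x + y - 1) / (1 - t * (1 - y))) \<le> z \<longleftrightarrow>
    t * (x + y - 1) \<le> (1 - t * (1 - y)) * z"
proof (cases "t * (x + y - 1) \<le> 0")
  case True
  have "t * (1 - y) \<le> 1" using assms by (intro mult_le_one) auto
  then have "0 \<le> (1 - t * (1 - y)) * z" using assms by simp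
  with True show ?thesis using assms by auto
next
  case False
  have "t * (x + y - 1) \<le> t * y" using assms by (intro mult_left_mono) auto
  with False assms have "0 < 1 - t * (1 - y)" by (simp add: algebra_simps)
  with False show ?thesis by (simp add: pos_divide_le_eq mult.commute)
qed

theorem theorem10:
  fixes A B C :: "'a::boolean_algebra"
    and x1 x2 y1 y2 t1 t2 :: real
  assumes "logically_independent3 A B C"
    and "0 \<le> x1" "x1 \<le> x2" "x2 \<le> 1"
    and "0 \<le> y1" "y1 \<le> y2" "y2 \<le> 1"
    and "0 \<le> t1" "t1 \<le> t2" "t2 \<le> 1"
  shows "coherent_extensions
           [Cond C B, Cond A B, Cond B (sup A B)]
           {[x, y, t] | x y t. x \<in> {x1..x2} \<and> y \<in> {y1..y2} \<and> t \<in> {t1..t2}}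
           (Cond C A) =
         {(if t1 * (x1 + y1 - 1) \<le> 0 then 0
           else t1 * (x1 + y1 - 1) / (1 - t1 * (1 - y1)))
          ..
          (if t1 * (y1 - x2) \<le> 0 then 1
           else 1 - t1 * (y1 - x2) / (1 - t1 * (1 - y1)))}"
proof -
  let ?F = "[Cond C B, Cond A B, Cond B (sup A B)]"
  let ?lower = "\<lambda>x y t z::real. t * (x + y - 1) \<le> (1 - t * (1 - y)) * z"
  have upper: "t * (y - x) \<le> (1 - t * (1 - y)) * (1 - z) \<longleftrightarrow> ?lower (1 - x) y t (1 - z)"
    for x y t z :: real by simp
  have ext: "coherent ?F [x, y, t] \<and> coherent (?F @ [Cond C A]) ([x, y, t] @ [z]) \<longleftrightarrow>
      ?lower x y t z \<and> ?lower (1 - x) y t (1 - z)"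
    if "x \<in> {x1..x2}" "y \<in> {y1..y2}" "t \<in> {t1..t2}" "z \<in> {0..1}" for x y t z
  proof -
    have "coherent (?F @ [Cond C A]) ([x, y, t] @ [z]) \<longleftrightarrow> ?lower x y t z \<and> ?lower (1 - x) y t (1 - z)"
      unfolding upper[symmetric] append.simps
      using that assms(2-) by (intro coherent_iff_bounds[OF assms(1)]) auto
    then show ?thesis using coherent_butlast by blast
  qed
  have box: "(\<exists>x\<in>{x1..x2}. \<exists>y\<in>{y1..y2}. \<exists>t\<in>{t1..t2}. ?lower x y t z \<and> ?lower (1 - x) y t (1 - z)) \<longleftrightarrow>
      ?lower x1 y1 t1 z \<and> ?lower (1 - x2) y1 t1 (1 - z)" (is "?ex \<longleftrightarrow> ?corner")
    if z: "z \<in> {0..1}" for z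
  proof
    assume ?ex
    then obtain x y t where *: "x \<in> {x1..x2}" "y \<in> {y1..y2}" "t \<in> {t1..t2}"
      "?lower x y t z" "?lower (1 - x) y t (1 - z)" by blast
    show ?corner
      by (intro conjI lower_bound_antimono[OF *(4)] lower_bound_antimono[OF *(5)])
        (use * z assms(8) in auto)
  next
    assume corner: ?corner
    \<comment> \<open>Take \<open>x\<^sub>1\<close> if possible, and otherwise the smallest \<open>x\<close> that satisfies the upper constraint,
      which is then an equality.\<close>
    define x where "x = (if ?lower (1 - x1) y1 t1 (1 - z) then x1
      else y1 - (1 - t1 * (1 - y1)) * (1 - z) / t1)"
    have "x \<in> {x1..x2} \<and> ?lower x y1 t1 z \<and> ?lower (1 - x) y1 t1 (1 - z)"
    proof (cases "?lower (1 - x1) y1 t1 (1 - z)")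
      case True
      then show ?thesis using corner assms(3) by (simp add: x_def)
    next
      case False
      have "t1 * (1 - y1) \<le> 1" using assms(5-10) by (intro mult_le_one) auto
      then have "t1 \<noteq> 0" using False z by auto
      then have t1: "0 < t1" using assms(8) by simp
      have tx: "t1 * x = t1 * y1 - (1 - t1 * (1 - y1)) * (1 - z)"
        using False t1 by (simp add: x_def field_simps)
      have "t1 * x1 \<le> t1 * x" "t1 * x \<le> t1 * x2"
        using False corner unfolding tx by (simp_all add: algebra_simps)
      then have "x1 \<le> x" "x \<le> x2" using t1 by simp_all
      moreover have "t1 * y1 \<le> 1" using assms(5-10) by (intro mult_le_one) auto
      ultimately show ?thesis
        using t1 tx by (simp add: algebra_simps)
    qed
    then show ?ex using assms(6,9) by (intro bexI[of _ x] bexI[of _ y1] bexI[of _ t1]) auto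
  qed
  let ?lo = "if t1 * (x1 + y1 - 1) \<le> 0 then 0 else t1 * (x1 + y1 - 1) / (1 - t1 * (1 - y1))"
  let ?up = "if t1 * (y1 - x2) \<le> 0 then 1 else 1 - t1 * (y1 - x2) / (1 - t1 * (1 - y1))"
  have lo: "?lo \<le> z \<longleftrightarrow> ?lower x1 y1 t1 z" if "z \<in> {0..1}" for z
    using assms(2-) that by (intro lower_bound_threshold) auto
  have up: "z \<le> ?up \<longleftrightarrow> ?lower (1 - x2) y1 t1 (1 - z)" if "z \<in> {0..1}" for z
    using lower_bound_threshold[of "1 - x2" y1 t1 "1 - z"] assms(2-) that
    by (auto split: if_splits)
  have "0 \<le> 1 - t1 * (1 - y1)" using assms(5-10) by (simp add: mult_le_one)
  then have unit: "0 \<le> ?lo" "?up \<le> 1" by simp_all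
  show ?thesis
  proof (rule set_eqI)
    fix z
    show "z \<in> coherent_extensions ?F {[x, y, t] | x y t. x \<in> {x1..x2} \<and> y \<in> {y1..y2} \<and> t \<in> {t1..t2}}
        (Cond C A) \<longleftrightarrow> z \<in> {?lo..?up}"
    proof (cases "z \<in> {0..1}")
      case True
      have "z \<in> coherent_extensions ?F {[x, y, t] | x y t. x \<in> {x1..x2} \<and> y \<in> {y1..y2} \<and> t \<in> {t1..t2}}
          (Cond C A) \<longleftrightarrow> (\<exists>x\<in>{x1..x2}. \<exists>y\<in>{y1..y2}. \<exists>t\<in>{t1..t2}.
            coherent ?F [x, y, t] \<and> coherent (?F @ [Cond C A]) ([x, y, t] @ [z]))"
        using True unfolding coherent_extensions_def by blast
      also have "\<dots> \<longleftrightarrow> ?lower x1 y1 t1 z \<and> ?lower (1 - x2) y1 t1 (1 - z)"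
        using ext[OF _ _ _ True] unfolding box[OF True, symmetric] by (intro bex_cong refl)
      also have "\<dots> \<longleftrightarrow> z \<in> {?lo..?up}"
        unfolding atLeastAtMost_iff lo[OF True] up[OF True] ..
      finally show ?thesis .
    next
      case False
      then have "z \<notin> {?lo..?up}"
        using unit unfolding atLeastAtMost_iff by (meson order_trans)
      then show ?thesis using False unfolding coherent_extensions_def by blast
    qed
  qed
qed

end
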